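(* A topological space $X$ is infraconsonant if and only if the product $(T[X,\$])^2$ of the Scott topologies on $\mathcal{O}_X$ and the Scott topology $T([X,\$]^2)$ on the product $\mathcal{O}_X\times\mathcal{O}_X$ coincide at $(X,X)$, i.e. the point $(X,X)$ has the same neighborhood filter for these two topologies.
   Context: For a topological space $X$, $\mathcal{O}_X$ is the set of open subsets of $X$, ordered by inclusion. $[X,\$]$ denotes $\mathcal{O}_X$ (identified with the continuous maps from $X$ to the Sierpiński space $\$$) with the convergence of filters given by $U\in\lim_{[X,\$]}\mathcal{F}$ iff $U\subseteq\bigcup_{F\in\mathcal{F}}\operatorname{int}\left(\bigcap_{O\in F}O\right)$. $[X,\$]^2$ is $\mathcal{O}_X\times\mathcal{O}_X$ with the product convergence: a filter converges to $(U,V)$ iff its two projections converge to $U$ and $V$ respectively. A set is open for a convergence if it belongs to every filter that converges to one of its points; $T$ of a convergence space denotes the underlying set with the topology formed by all such open sets. $T[X,\$]$ is $\mathcal{O}_X$ with its Scott topology: its open sets are the families $\mathcal{A}\subseteq\mathcal{O}_X$ closed under open supersets and such that whenever $\bigcup_{i\in I}O_i\in\mathcal{A}$ with each $O_i$ open, there is a finite $J\subseteq I$ with $\bigcup_{i\in J}O_i\in\mathcal{A}$. $(T[X,\$])^2$ is the topological product. $T([X,\$]^2)$ is the Scott topology of the complete lattice $\mathcal{O}_X\times\mathcal{O}_X$ with the coordinatewise inclusion order (open sets: upper sets $\mathcal{S}$ such that every directed subset with supremum in $\mathcal{S}$ meets $\mathcal{S}$). A topological space $X$ is infraconsonant if for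 every nonempty Scott open subset $\mathcal{A}$ of $\mathcal{O}_X$ there is a nonempty Scott open subset $\mathcal{C}$ of $\mathcal{O}_X$ such that $\mathcal{C}\vee\mathcal{C}\subseteq\mathcal{A}$, where $\mathcal{C}\vee\mathcal{C}:=\{C\cap D:C,D\in\mathcal{C}\}$. *)

theory Defs
  imports "HOL-Analysis.Analysis"
begin

record 'b convergence =
  points :: "'b set"
  converges :: "'b filter \<Rightarrow> 'b \<Rightarrow> bool"

text \<open>
  A filter on the set of points is a filter of the ambient type below \<open>principal (points C)\<close>.
  The improper filter \<open>bot\<close> is admitted; this is harmless, since every set belongs to it.
\<close>

definition conv_open :: "'b convergence \<Rightarrow> 'b set \<Rightarrow> bool" where
  "conv_open C A \<longleftrightarrow> A \<subseteq> points C \<and>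
     (\<forall>F. F \<le> principal (points C) \<longrightarrow> (\<exists>x\<in>A. converges C F x) \<longrightarrow> eventually (\<lambda>y. y \<in> A) F)"

definition conv_topology :: "'b convergence \<Rightarrow> 'b topology" where
  "conv_topology C = topology (conv_open C)"

lemma istopology_conv_open: "istopology (conv_open C)"
  unfolding istopology_def
proof (intro conjI allI impI)
  fix A B assume "conv_open C A" "conv_open C B"
  then show "conv_open C (A \<inter> B)"
    by (auto simp: conv_open_def eventually_conj_iff)
next
  fix K assume "\<forall>A\<in>K. conv_open C A"
  then show "conv_open C (\<Union>K)"
    unfolding conv_open_def by (fastforce elim: eventually_mono)
qed

lemma openin_conv_topology: "openin (conv_topology C) A \<longleftrightarrow> conv_open C A"
  by (simp add: conv_topology_def topology_inverse' istopology_conv_open)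

lemma topspace_conv_topology: "topspace (conv_topology C) = points C"
proof -
  have "conv_open C (points C)"
    by (simp add: conv_open_def le_principal)
  then show ?thesis
    unfolding topspace_def openin_conv_topology by (auto simp: conv_open_def)
qed

definition prod_convergence ::
    "'b convergence \<Rightarrow> 'c convergence \<Rightarrow> ('b \<times> 'c) convergence" where
  "prod_convergence C D =
     \<lparr>points = points C \<times> points D,
      converges = (\<lambda>F z. converges C (filtermap fst F) (fst z) \<and>
                         converges D (filtermap snd F) (snd z))\<rparr>"


abbreviation opens :: "'a topology \<Rightarrow> 'a set set" where
  "opens X \<equiv> Collect (openin X)"

definition open_convergence :: "'a topology \<Rightarrow> 'a set convergence" where
  "open_convergence X =
     \<lparr>points = opens X,
      converges = (\<lambda>F U. U \<subseteq> \<Union>{X interior_of (\<Inter>\<F>) |\<F>.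
                       \<F> \<subseteq> opens X \<and> eventually (\<lambda>W. W \<in> \<F>) F})\<rparr>"

definition scott_open :: "'a topology \<Rightarrow> 'a set set \<Rightarrow> bool" where
  "scott_open X A \<longleftrightarrow> A \<subseteq> opens X \<and>
     (\<forall>U\<in>A. \<forall>V. openin X V \<and> U \<subseteq> V \<longrightarrow> V \<in> A) \<and>
     (\<forall>K. K \<subseteq> opens X \<and> \<Union>K \<in> A \<longrightarrow> (\<exists>J. finite J \<and> J \<subseteq> K \<and> \<Union>J \<in> A))"

definition infraconsonant :: "'a topology \<Rightarrow> bool" where
  "infraconsonant X \<longleftrightarrow>
     (\<forall>A. scott_open X A \<and> A \<noteq> {} \<longrightarrow>
       (\<exists>C. scott_open X C \<and> C \<noteq> {} \<and> {U \<inter> V |U V. U \<in> C \<and> V \<in> C} \<subseteq> A))"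


lemma points_open_convergence [simp]: "points (open_convergence X) = opens X"
  by (simp add: open_convergence_def)

lemma points_prod_convergence [simp]:
  "points (prod_convergence C D) = points C \<times> points D"
  by (simp add: prod_convergence_def)

lemma converges_open_convergence:
  "converges (open_convergence X) F U \<longleftrightarrow>
     (\<forall>x\<in>U. \<exists>\<F>. \<F> \<subseteq> opens X \<and> eventually (\<lambda>W. W \<in> \<F>) F \<and> x \<in> X interior_of (\<Inter>\<F>))"
proof -
  have "U \<subseteq> \<Union>{X interior_of (\<Inter>\<F>) |\<F>. Q \<F>} \<longleftrightarrow> (\<forall>x\<in>U. \<exists>\<F>. Q \<F> \<and> x \<in> X interior_of (\<Inter>\<F>))" for Q
    by blast
  then show ?thesis
    by (simp add: open_convergence_def conj_assoc)
qed

lemma converges_prod_convergence: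
  "converges (prod_convergence C D) F z \<longleftrightarrow>
     converges C (filtermap fst F) (fst z) \<and> converges D (filtermap snd F) (snd z)"
  by (simp add: prod_convergence_def)

lemma subset_interior_Inter:
  assumes "openin X V" "\<And>W. W \<in> \<F> \<Longrightarrow> V \<subseteq> W"
  shows "V \<subseteq> X interior_of (\<Inter>\<F>)"
  using assms by (intro interior_of_maximal) auto

theorem openin_T_open_convergence:
  "openin (conv_topology (open_convergence X)) A \<longleftrightarrow> scott_open X A"
proof
  assume "openin (conv_topology (open_convergence X)) A"
  then have sub: "A \<subseteq> opens X"
    and co: "\<And>F U. F \<le> principal (opens X) \<Longrightarrow> U \<in> A \<Longrightarrow> converges (open_convergence X) F U
             \<Longrightarrow> eventually (\<lambda>y. y \<in> A) F"
    unfolding openin_conv_topology conv_open_def by auto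
  have up: "V \<in> A" if "U \<in> A" "openin X V" "U \<subseteq> V" for U V
  proof -
    have "converges (open_convergence X) (principal {V}) U"
      unfolding converges_open_convergence using that
      by (intro ballI exI[of _ "{V}"]) (auto simp: eventually_principal interior_of_openin)
    from co[OF _ that(1) this] that show ?thesis
      by (auto simp: eventually_principal)
  qed
  have "\<exists>J. finite J \<and> J \<subseteq> K \<and> \<Union>J \<in> A" if K: "K \<subseteq> opens X" "\<Union>K \<in> A" for K
  proof -
    define P where "P J = {W. openin X W \<and> \<Union>J \<subseteq> W}" for J
    define F where "F = (INF J\<in>{J. finite J \<and> J \<subseteq> K}. principal (P J))"
    have ev: "eventually Q F \<longleftrightarrow> (\<exists>J\<in>{J. finite J \<and> J \<subseteq> K}. eventually Q (principal (P J)))" for Q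
      unfolding F_def
    proof (rule eventually_INF_base)
      fix a b assume "a \<in> {J. finite J \<and> J \<subseteq> K}" "b \<in> {J. finite J \<and> J \<subseteq> K}"
      then show "\<exists>x\<in>{J. finite J \<and> J \<subseteq> K}. principal (P x) \<le> inf (principal (P a)) (principal (P b))"
        by (intro bexI[of _ "a \<union> b"]) (auto simp: P_def)
    qed blast
    have le: "F \<le> principal (opens X)"
      unfolding le_principal ev by (rule bexI[of _ "{}"]) (auto simp: eventually_principal P_def)
    have "converges (open_convergence X) F (\<Union>K)"
      unfolding converges_open_convergence
    proof
      fix x assume "x \<in> \<Union>K"
      then obtain k where k: "k \<in> K" "x \<in> k" by auto
      have "eventually (\<lambda>W. W \<in> P {k}) F"
        unfolding ev using k by (intro bexI[of _ "{k}"]) (auto simp: eventually_principal)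
      moreover have "k \<subseteq> X interior_of (\<Inter>(P {k}))"
        using k K by (intro subset_interior_Inter) (auto simp: P_def)
      ultimately show "\<exists>\<F>\<subseteq>opens X. eventually (\<lambda>W. W \<in> \<F>) F \<and> x \<in> X interior_of (\<Inter>\<F>)"
        using k by (intro exI[of _ "P {k}"]) (auto simp: P_def)
    qed
    from co[OF le K(2) this] obtain J where J: "finite J" "J \<subseteq> K" "P J \<subseteq> A"
      unfolding ev by (auto simp: eventually_principal)
    have "\<Union>J \<in> P J"
      using J K by (auto simp: P_def)
    with J show ?thesis by blast
  qed
  with sub up show "scott_open X A"
    unfolding scott_open_def by blast
next
  assume sc: "scott_open X A"
  have "eventually (\<lambda>y. y \<in> A) F"
    if F: "F \<le> principal (opens X)" and U: "U \<in> A" and conv: "converges (open_convergence X) F U"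
    for F U
  proof -
    define K where "K = {X interior_of (\<Inter>\<F>) |\<F>. \<F> \<subseteq> opens X \<and> eventually (\<lambda>W. W \<in> \<F>) F}"
    have KO: "K \<subseteq> opens X" by (auto simp: K_def)
    have "U \<subseteq> \<Union>K"
      using conv unfolding open_convergence_def K_def by simp
    moreover have "openin X (\<Union>K)" using KO by blast
    ultimately have "\<Union>K \<in> A"
      using sc U unfolding scott_open_def by blast
    then obtain J where J: "finite J" "J \<subseteq> K" "\<Union>J \<in> A"
      using sc KO unfolding scott_open_def by (elim conjE allE[of _ K]) auto
    have "\<forall>k\<in>J. eventually (\<lambda>W. openin X W \<and> k \<subseteq> W) F"
    proof
      fix k assume "k \<in> J"
      with J obtain \<F> where \<F>: "k = X interior_of (\<Inter>\<F>)" "\<F> \<subseteq> opens X" "eventually (\<lambda>W. W \<in> \<F>) F"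
        unfolding K_def by blast
      have "k \<subseteq> \<Inter>\<F>" using \<F>(1) interior_of_subset by metis
      with \<F> show "eventually (\<lambda>W. openin X W \<and> k \<subseteq> W) F"
        by (auto elim!: eventually_mono)
    qed
    then have "eventually (\<lambda>W. \<forall>k\<in>J. openin X W \<and> k \<subseteq> W) F"
      using J(1) by (simp add: eventually_ball_finite)
    moreover have "eventually (\<lambda>W. openin X W) F"
      using F by (simp add: le_principal)
    ultimately show ?thesis
    proof eventually_elim
      case (elim W)
      then have "\<Union>J \<subseteq> W" by blast
      with elim J sc show ?case unfolding scott_open_def by blast
    qed
  qed
  then show "openin (conv_topology (open_convergence X)) A"
    using sc unfolding openin_conv_topology conv_open_def scott_open_def by auto
qed

definition scott_open_prod :: "'a topology \<Rightarrow> ('a set \<times> 'a set) set \<Rightarrow> bool" where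
  "scott_open_prod X S \<longleftrightarrow> S \<subseteq> opens X \<times> opens X \<and>
     (\<forall>(U, V)\<in>S. \<forall>U' V'. openin X U' \<and> openin X V' \<and> U \<subseteq> U' \<and> V \<subseteq> V' \<longrightarrow> (U', V') \<in> S) \<and>
     (\<forall>D. D \<subseteq> opens X \<times> opens X \<and> D \<noteq> {} \<and>
          (\<forall>p\<in>D. \<forall>q\<in>D. \<exists>r\<in>D. fst p \<union> fst q \<subseteq> fst r \<and> snd p \<union> snd q \<subseteq> snd r) \<and>
          (\<Union>(fst ` D), \<Union>(snd ` D)) \<in> S \<longrightarrow> D \<inter> S \<noteq> {})"

theorem openin_T_prod_open_convergence:
  "openin (conv_topology (prod_convergence (open_convergence X) (open_convergence X))) S
     \<longleftrightarrow> scott_open_prod X S"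
  (is "openin (conv_topology ?C) S \<longleftrightarrow> _")
proof
  assume "openin (conv_topology ?C) S"
  then have sub: "S \<subseteq> opens X \<times> opens X"
    and co: "\<And>F z. F \<le> principal (opens X \<times> opens X) \<Longrightarrow> z \<in> S \<Longrightarrow> converges ?C F z
             \<Longrightarrow> eventually (\<lambda>y. y \<in> S) F"
    unfolding openin_conv_topology conv_open_def by auto
  have up: "(U', V') \<in> S"
    if "(U, V) \<in> S" "openin X U'" "openin X V'" "U \<subseteq> U'" "V \<subseteq> V'" for U V U' V'
  proof -
    have aux: "converges (open_convergence X) (principal {W'}) W" if "openin X W'" "W \<subseteq> W'" for W W'
      unfolding converges_open_convergence using that
      by (intro ballI exI[of _ "{W'}"]) (auto simp: eventually_principal interior_of_openin)
    have "converges ?C (principal {(U', V')}) (U, V)"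
      unfolding converges_prod_convergence using that aux by simp
    from co[OF _ that(1) this] that show ?thesis
      by (auto simp: eventually_principal)
  qed
  have "D \<inter> S \<noteq> {}"
    if D: "D \<subseteq> opens X \<times> opens X" "D \<noteq> {}"
      and dir: "\<forall>p\<in>D. \<forall>q\<in>D. \<exists>r\<in>D. fst p \<union> fst q \<subseteq> fst r \<and> snd p \<union> snd q \<subseteq> snd r"
      and sup: "(\<Union>(fst ` D), \<Union>(snd ` D)) \<in> S" for D
  proof -
    define P where "P d = {W. openin X (fst W) \<and> openin X (snd W) \<and> fst d \<subseteq> fst W \<and> snd d \<subseteq> snd W}"
      for d :: "'a set \<times> 'a set"
    define F where "F = (INF d\<in>D. principal (P d))"
    have ev: "eventually Q F \<longleftrightarrow> (\<exists>d\<in>D. eventually Q (principal (P d)))" for Q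
      unfolding F_def
    proof (rule eventually_INF_base)
      fix a b assume "a \<in> D" "b \<in> D"
      with dir obtain r where "r \<in> D" "fst a \<union> fst b \<subseteq> fst r \<and> snd a \<union> snd b \<subseteq> snd r" by blast
      then show "\<exists>x\<in>D. principal (P x) \<le> inf (principal (P a)) (principal (P b))"
        by (intro bexI[of _ r]) (auto simp: P_def)
    qed (rule D(2))
    have le: "F \<le> principal (opens X \<times> opens X)"
      using D(2) unfolding le_principal ev by (auto simp: eventually_principal P_def)
    have 1: "converges (open_convergence X) (filtermap fst F) (\<Union>(fst ` D))"
      unfolding converges_open_convergence
    proof
      fix x assume "x \<in> \<Union>(fst ` D)"
      then obtain d where d: "d \<in> D" "x \<in> fst d" by auto
      let ?P = "{W. openin X W \<and> fst d \<subseteq> W}"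
      have "eventually (\<lambda>W. W \<in> ?P) (filtermap fst F)"
        unfolding eventually_filtermap ev using d
        by (intro bexI[of _ d]) (auto simp: eventually_principal P_def)
      moreover have "fst d \<subseteq> X interior_of (\<Inter>?P)"
        using d D(1) by (intro subset_interior_Inter) auto
      ultimately show "\<exists>\<F>\<subseteq>opens X. eventually (\<lambda>W. W \<in> \<F>) (filtermap fst F) \<and> x \<in> X interior_of (\<Inter>\<F>)"
        using d by (intro exI[of _ ?P]) auto
    qed
    have 2: "converges (open_convergence X) (filtermap snd F) (\<Union>(snd ` D))"
      unfolding converges_open_convergence
    proof
      fix x assume "x \<in> \<Union>(snd ` D)"
      then obtain d where d: "d \<in> D" "x \<in> snd d" by auto
      let ?P = "{W. openin X W \<and> snd d \<subseteq> W}"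
      have "eventually (\<lambda>W. W \<in> ?P) (filtermap snd F)"
        unfolding eventually_filtermap ev using d
        by (intro bexI[of _ d]) (auto simp: eventually_principal P_def)
      moreover have "snd d \<subseteq> X interior_of (\<Inter>?P)"
        using d D(1) by (intro subset_interior_Inter) auto
      ultimately show "\<exists>\<F>\<subseteq>opens X. eventually (\<lambda>W. W \<in> \<F>) (filtermap snd F) \<and> x \<in> X interior_of (\<Inter>\<F>)"
        using d by (intro exI[of _ ?P]) auto
    qed
    have "eventually (\<lambda>y. y \<in> S) F"
      by (rule co[OF le sup]) (simp add: converges_prod_convergence 1 2)
    then obtain d where d: "d \<in> D" "P d \<subseteq> S"
      unfolding ev by (auto simp: eventually_principal)
    have "d \<in> P d" using d D(1) by (auto simp: P_def)
    with d show ?thesis by blast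
  qed
  note dirs = this
  show "scott_open_prod X S"
    unfolding scott_open_prod_def
  proof (intro conjI)
    show "S \<subseteq> opens X \<times> opens X" by (rule sub)
    show "\<forall>(U, V)\<in>S. \<forall>U' V'. openin X U' \<and> openin X V' \<and> U \<subseteq> U' \<and> V \<subseteq> V' \<longrightarrow> (U', V') \<in> S"
      using up by auto
    show "\<forall>D. D \<subseteq> opens X \<times> opens X \<and> D \<noteq> {} \<and>
          (\<forall>p\<in>D. \<forall>q\<in>D. \<exists>r\<in>D. fst p \<union> fst q \<subseteq> fst r \<and> snd p \<union> snd q \<subseteq> snd r) \<and>
          (\<Union>(fst ` D), \<Union>(snd ` D)) \<in> S \<longrightarrow> D \<inter> S \<noteq> {}"
      by (intro allI impI dirs) (elim conjE; assumption)+
  qed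
next
  assume sc: "scott_open_prod X S"
  have up: "(U', V') \<in> S"
    if "(U, V) \<in> S" "openin X U'" "openin X V'" "U \<subseteq> U'" "V \<subseteq> V'" for U V U' V'
  proof -
    have "\<forall>(U, V)\<in>S. \<forall>U' V'. openin X U' \<and> openin X V' \<and> U \<subseteq> U' \<and> V \<subseteq> V' \<longrightarrow> (U', V') \<in> S"
      using sc unfolding scott_open_prod_def by (elim conjE)
    with that show ?thesis by fast
  qed
  have "eventually (\<lambda>y. y \<in> S) F"
    if F: "F \<le> principal (opens X \<times> opens X)" and z: "z \<in> S" and conv: "converges ?C F z" for F z
  proof -
    define N where "N G = {\<F>. \<F> \<subseteq> opens X \<and> eventually (\<lambda>W. W \<in> \<F>) G}" for G
    define I where "I \<F> = X interior_of (\<Inter>\<F>)" for \<F>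
    define N1 where "N1 = N (filtermap fst F)"
    define N2 where "N2 = N (filtermap snd F)"
    define D where "D = (I ` N1) \<times> (I ` N2)"
    have oI: "openin X (I \<F>)" for \<F> by (simp add: I_def)
    have evF: "eventually (\<lambda>W. openin X (fst W) \<and> openin X (snd W)) F"
      using F unfolding le_principal by (auto elim!: eventually_mono)
    have "opens X \<in> N1" "opens X \<in> N2"
      using evF unfolding N1_def N2_def N_def by (auto simp: eventually_filtermap elim!: eventually_mono)
    then have ne: "I ` N1 \<noteq> {}" "I ` N2 \<noteq> {}" by auto
    have Iint: "\<exists>\<H>\<in>N G. I \<F> \<union> I \<G> \<subseteq> I \<H>" if "\<F> \<in> N G" "\<G> \<in> N G" for \<F> \<G> G
    proof -
      have "\<F> \<inter> \<G> \<in> N G"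
        using that unfolding N_def by (auto simp: eventually_conj_iff)
      moreover have "I \<F> \<subseteq> I (\<F> \<inter> \<G>)" "I \<G> \<subseteq> I (\<F> \<inter> \<G>)"
        unfolding I_def by (intro interior_of_mono; blast)+
      ultimately show ?thesis by blast
    qed
    have dir: "\<exists>r\<in>D. fst p \<union> fst q \<subseteq> fst r \<and> snd p \<union> snd q \<subseteq> snd r"
      if pq: "p \<in> D" "q \<in> D" for p q
    proof -
      from pq obtain a b c d where
        abcd: "a \<in> N1" "b \<in> N2" "c \<in> N1" "d \<in> N2" "p = (I a, I b)" "q = (I c, I d)"
        unfolding D_def by auto
      obtain g where "g \<in> N1" "I a \<union> I c \<subseteq> I g" using Iint abcd unfolding N1_def by blast
      moreover obtain h where "h \<in> N2" "I b \<union> I d \<subseteq> I h" using Iint abcd unfolding N2_def by blast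
      ultimately show ?thesis
        using abcd by (intro bexI[of _ "(I g, I h)"]) (auto simp: D_def)
    qed
    have U: "fst z \<subseteq> \<Union>(I ` N1)" "snd z \<subseteq> \<Union>(I ` N2)"
      using conv unfolding converges_prod_convergence converges_open_convergence N1_def N2_def N_def I_def
      by blast+
    have op: "openin X (\<Union>(I ` N1))" "openin X (\<Union>(I ` N2))" using oI by blast+
    have "(\<Union>(I ` N1), \<Union>(I ` N2)) \<in> S"
      using up[of "fst z" "snd z"] z U op by simp
    moreover have "fst ` D = I ` N1" "snd ` D = I ` N2"
      unfolding D_def using ne by auto
    ultimately have "(\<Union>(fst ` D), \<Union>(snd ` D)) \<in> S" by simp
    moreover have "D \<subseteq> opens X \<times> opens X" "D \<noteq> {}"
      using oI ne unfolding D_def by auto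
    moreover have "\<forall>p\<in>D. \<forall>q\<in>D. \<exists>r\<in>D. fst p \<union> fst q \<subseteq> fst r \<and> snd p \<union> snd q \<subseteq> snd r"
      by (intro ballI dir)
    ultimately have "D \<inter> S \<noteq> {}"
      using sc unfolding scott_open_prod_def by (elim conjE allE[of _ D]) (erule mp, intro conjI)
    then obtain a b where ab: "a \<in> N1" "b \<in> N2" "(I a, I b) \<in> S"
      unfolding D_def by blast
    have "eventually (\<lambda>W. fst W \<in> a) F" "eventually (\<lambda>W. snd W \<in> b) F"
      using ab unfolding N1_def N2_def N_def by (auto simp: eventually_filtermap)
    with evF show ?thesis
    proof eventually_elim
      case (elim W)
      have "I a \<subseteq> \<Inter>a" "I b \<subseteq> \<Inter>b" unfolding I_def by (rule interior_of_subset)+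
      with elim have "I a \<subseteq> fst W" "I b \<subseteq> snd W" by blast+
      with up[OF ab(3), of "fst W" "snd W"] elim show ?case by simp
    qed
  qed
  moreover have "S \<subseteq> opens X \<times> opens X"
    using sc unfolding scott_open_prod_def by (elim conjE)
  ultimately show "openin (conv_topology ?C) S"
    unfolding openin_conv_topology conv_open_def by auto
qed

end

theory Submission
  imports Defs
begin

text \<open>
  Write \<open>S\<close> for the convergence space of open sets and \<open>T\<close> for the passage to the topology of
  open sets.  Continuous maps of convergence spaces stay continuous under \<open>T\<close>
  (\<open>continuous_map_conv_topology\<close>).  Hence the projections, the diagonal
  \<open>U \<mapsto> (U, U)\<close> and the intersection \<open>(U, V) \<mapsto> U \<inter> V\<close> are continuous between \<open>T S\<close> and
  \<open>T (S \<times> S)\<close>.  For intersection this is where \<open>T (S \<times> S)\<close> matters: the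
  map need not be continuous on \<open>T S \<times> T S\<close>.

  The projections show that \<open>T (S \<times> S)\<close> is always finer than \<open>T S \<times> T S\<close>, so the neighbourhood
  filters at the top point agree iff every open set of \<open>T (S \<times> S)\<close> around that point contains a
  square \<open>C \<times> C\<close> of a nonempty Scott open \<open>C\<close> (a nonempty Scott open family contains the whole
  space, and two of them may be intersected to make a rectangle a square); see
  \<open>nhdsin_prod_eq_iff_squares\<close>.
  The diagonal and intersection translate this into infraconsonance.  If \<open>\<A>\<close> is Scott open, the
  pairs with \<open>U \<inter> V \<in> \<A>\<close> form an open set of \<open>T (S \<times> S)\<close>, and a square \<open>C \<times> C\<close> lies in it iff
  \<open>U \<inter> V \<in> \<A>\<close> for all \<open>U, V \<in> C\<close>.  Conversely, if \<open>\<S>\<close> is open in \<open>T (S \<times> S)\<close>, apply infraconsonance to the family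
  of all \<open>U\<close> with \<open>(U, U) \<in> \<S>\<close>: for \<open>U, V \<in> C\<close> the pair \<open>(U \<inter> V, U \<inter> V)\<close> lies in \<open>\<S>\<close>, and so
  does the larger pair \<open>(U, V)\<close>.
\<close>

text \<open>
  If \<open>F\<close> converges to \<open>x\<close>, its image converges to \<open>f x\<close>, so an open set around \<open>f x\<close> belongs
  to the image filter and its preimage to \<open>F\<close>.
\<close>

lemma continuous_map_conv_topology:
  assumes maps: "\<And>x. x \<in> points C \<Longrightarrow> f x \<in> points D"
    and conv: "\<And>F x. \<lbrakk>F \<le> principal (points C); x \<in> points C; converges C F x\<rbrakk>
                 \<Longrightarrow> converges D (filtermap f F) (f x)"
  shows "continuous_map (conv_topology C) (conv_topology D) f"
  unfolding continuous_map topspace_conv_topology openin_conv_topology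
proof (intro conjI allI impI)
  show "f ` points C \<subseteq> points D"
    using maps by auto
  fix A assume A: "conv_open D A"
  have "eventually (\<lambda>y. y \<in> points C \<and> f y \<in> A) F"
    if F: "F \<le> principal (points C)" and x: "x \<in> points C" "f x \<in> A" "converges C F x" for F x
  proof -
    have evC: "eventually (\<lambda>y. y \<in> points C) F"
      using F by (simp add: le_principal)
    then have "filtermap f F \<le> principal (points D)"
      using maps by (auto simp: le_principal eventually_filtermap elim: eventually_mono)
    then have "eventually (\<lambda>y. y \<in> A) (filtermap f F)"
      using A conv[OF F x(1,3)] x(2) unfolding conv_open_def by blast
    with evC show ?thesis
      by (simp add: eventually_filtermap eventually_conj_iff)
  qed
  then show "conv_open C {x \<in> points C. f x \<in> A}"
    unfolding conv_open_def by auto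
qed

lemma continuous_map_prod_convergence_id:
  "continuous_map (conv_topology (prod_convergence C D))
     (prod_topology (conv_topology C) (conv_topology D)) id"
  unfolding continuous_map_pairwise
  by (auto intro!: continuous_map_conv_topology simp: converges_prod_convergence)

lemma continuous_map_diagonal_convergence:
  "continuous_map (conv_topology C) (conv_topology (prod_convergence C C)) (\<lambda>x. (x, x))"
  by (rule continuous_map_conv_topology)
     (simp_all add: converges_prod_convergence filtermap_filtermap)

text \<open>
  If \<open>x\<close> is interior to the intersections of two families witnessing convergence of the
  projections, it is interior to the intersection of the family of pairwise intersections.
\<close>

lemma converges_Int:
  assumes "converges (prod_convergence (open_convergence X) (open_convergence X)) F (U, V)"
  shows "converges (open_convergence X) (filtermap (\<lambda>(U, V). U \<inter> V) F) (U \<inter> V)"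
  unfolding converges_open_convergence
proof
  fix x assume "x \<in> U \<inter> V"
  then have x: "x \<in> U" "x \<in> V"
    by auto
  obtain \<F> where \<F>: "\<F> \<subseteq> opens X" "eventually (\<lambda>W. fst W \<in> \<F>) F" "x \<in> X interior_of (\<Inter>\<F>)"
    using assms x(1)
    unfolding converges_prod_convergence converges_open_convergence eventually_filtermap fst_conv
    by blast
  obtain \<G> where \<G>: "\<G> \<subseteq> opens X" "eventually (\<lambda>W. snd W \<in> \<G>) F" "x \<in> X interior_of (\<Inter>\<G>)"
    using assms x(2)
    unfolding converges_prod_convergence converges_open_convergence eventually_filtermap snd_conv
    by blast
  define \<H> where "\<H> = {A \<inter> B |A B. A \<in> \<F> \<and> B \<in> \<G>}"
  have "X interior_of (\<Inter>\<F>) \<inter> X interior_of (\<Inter>\<G>) \<subseteq> X interior_of (\<Inter>\<H>)"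
    unfolding interior_of_Int[symmetric] by (rule interior_of_mono) (auto simp: \<H>_def)
  with \<F>(3) \<G>(3) have "x \<in> X interior_of (\<Inter>\<H>)"
    by blast
  moreover have "\<H> \<subseteq> opens X"
    using \<F>(1) \<G>(1) by (auto simp: \<H>_def)
  moreover have "eventually (\<lambda>W. W \<in> \<H>) (filtermap (\<lambda>(U, V). U \<inter> V) F)"
    unfolding eventually_filtermap using \<F>(2) \<G>(2)
    by eventually_elim (unfold \<H>_def case_prod_unfold, blast)
  ultimately show "\<exists>\<H>\<subseteq>opens X. eventually (\<lambda>W. W \<in> \<H>) (filtermap (\<lambda>(U, V). U \<inter> V) F)
                     \<and> x \<in> X interior_of (\<Inter>\<H>)"
    by blast
qed

lemma continuous_map_Int:
  "continuous_map (conv_topology (prod_convergence (open_convergence X) (open_convergence X)))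
     (conv_topology (open_convergence X)) (\<lambda>(U, V). U \<inter> V)"
proof (rule continuous_map_conv_topology, goal_cases)
  case (1 z)
  then show ?case by auto
next
  case (2 F z)
  then show ?case using converges_Int by (cases z) simp
qed

lemma scott_open_nonempty_iff:
  assumes "scott_open X A"
  shows "A \<noteq> {} \<longleftrightarrow> topspace X \<in> A"
proof
  assume "A \<noteq> {}"
  then obtain U where U: "U \<in> A" by blast
  with assms have "openin X U" and up: "\<And>V. openin X V \<Longrightarrow> U \<subseteq> V \<Longrightarrow> V \<in> A"
    by (auto simp: scott_open_def)
  then show "topspace X \<in> A"
    by (simp add: openin_subset)
qed blast

lemma scott_open_Int:
  assumes "scott_open X A" "scott_open X B"
  shows "scott_open X (A \<inter> B)"
  using assms unfolding openin_T_open_convergence[symmetric] by (rule openin_Int)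

lemma scott_open_prod_mono:
  assumes "scott_open_prod X S" "(U, V) \<in> S"
    and "openin X U'" "openin X V'" "U \<subseteq> U'" "V \<subseteq> V'"
  shows "(U', V') \<in> S"
proof -
  have "\<forall>(U, V)\<in>S. \<forall>U' V'. openin X U' \<and> openin X V' \<and> U \<subseteq> U' \<and> V \<subseteq> V' \<longrightarrow> (U', V') \<in> S"
    using assms(1) unfolding scott_open_prod_def by (elim conjE)
  with assms(2-) show ?thesis by fast
qed

lemma scott_open_diagonal:
  assumes "scott_open_prod X S"
  shows "scott_open X {U. openin X U \<and> (U, U) \<in> S}"
  using openin_continuous_map_preimage[OF continuous_map_diagonal_convergence
      assms[folded openin_T_prod_open_convergence]]
  by (simp add: topspace_conv_topology openin_T_open_convergence)

lemma scott_open_prod_Int: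
  assumes "scott_open X A"
  shows "scott_open_prod X {(U, V). openin X U \<and> openin X V \<and> U \<inter> V \<in> A}"
proof -
  have "{(U, V). openin X U \<and> openin X V \<and> U \<inter> V \<in> A}
        = {z \<in> opens X \<times> opens X. (case z of (U, V) \<Rightarrow> U \<inter> V) \<in> A}"
    by auto
  then show ?thesis
    using openin_continuous_map_preimage[OF continuous_map_Int
        assms[folded openin_T_open_convergence]]
    by (simp add: topspace_conv_topology openin_T_prod_open_convergence)
qed

lemma nhdsin_le_iff:
  assumes "topspace X = topspace Y" "a \<in> topspace X"
  shows "nhdsin X a \<le> nhdsin Y a
    \<longleftrightarrow> (\<forall>V. openin Y V \<and> a \<in> V \<longrightarrow> (\<exists>U. openin X U \<and> a \<in> U \<and> U \<subseteq> V))"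
proof
  assume le: "nhdsin X a \<le> nhdsin Y a"
  show "\<forall>V. openin Y V \<and> a \<in> V \<longrightarrow> (\<exists>U. openin X U \<and> a \<in> U \<and> U \<subseteq> V)"
  proof (intro allI impI)
    fix V assume "openin Y V \<and> a \<in> V"
    then have "eventually (\<lambda>y. y \<in> V) (nhdsin Y a)"
      using assms by (auto simp: eventually_nhdsin)
    with le have "eventually (\<lambda>y. y \<in> V) (nhdsin X a)"
      by (rule filter_leD)
    then show "\<exists>U. openin X U \<and> a \<in> U \<and> U \<subseteq> V"
      using assms by (auto simp: eventually_nhdsin)
  qed
next
  assume "\<forall>V. openin Y V \<and> a \<in> V \<longrightarrow> (\<exists>U. openin X U \<and> a \<in> U \<and> U \<subseteq> V)"
  then show "nhdsin X a \<le> nhdsin Y a"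
    using assms unfolding le_filter_def eventually_nhdsin by (metis subsetD)
qed

text \<open>
  One inclusion of neighbourhood filters is free because the product convergence has the finer
  topology; the other is tested on basic rectangles, which shrink to squares.
\<close>

lemma nhdsin_prod_eq_iff_squares:
  fixes X :: "'a topology"
  defines "T \<equiv> conv_topology (open_convergence X)"
    and "T2 \<equiv> conv_topology (prod_convergence (open_convergence X) (open_convergence X))"
  shows "nhdsin (prod_topology T T) (topspace X, topspace X) = nhdsin T2 (topspace X, topspace X)
    \<longleftrightarrow> (\<forall>S. scott_open_prod X S \<and> (topspace X, topspace X) \<in> S
          \<longrightarrow> (\<exists>C. scott_open X C \<and> C \<noteq> {} \<and> C \<times> C \<subseteq> S))"
    (is "nhdsin ?P ?z = _ \<longleftrightarrow> _")
proof -
  have top: "topspace ?P = topspace T2" and z: "?z \<in> topspace ?P"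
    by (simp_all add: T_def T2_def topspace_conv_topology)
  have cont: "continuous_map T2 ?P id"
    unfolding T_def T2_def by (rule continuous_map_prod_convergence_id)
  have "openin T2 V" if V: "openin ?P V" for V
  proof -
    have "openin T2 {x \<in> topspace T2. id x \<in> V}"
      using cont V by (rule openin_continuous_map_preimage)
    moreover have "{x \<in> topspace T2. id x \<in> V} = V"
      using openin_subset[OF V] unfolding top by auto
    ultimately show ?thesis by simp
  qed
  then have le: "nhdsin T2 ?z \<le> nhdsin ?P ?z"
    using top z by (subst nhdsin_le_iff) auto
  have square: "(\<exists>U. openin ?P U \<and> ?z \<in> U \<and> U \<subseteq> S)
      \<longleftrightarrow> (\<exists>C. scott_open X C \<and> C \<noteq> {} \<and> C \<times> C \<subseteq> S)" for S
  proof
    assume "\<exists>U. openin ?P U \<and> ?z \<in> U \<and> U \<subseteq> S"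
    then obtain U where U: "openin ?P U" "?z \<in> U" "U \<subseteq> S"
      by blast
    then obtain A B where "openin T A" "openin T B" "?z \<in> A \<times> B" "A \<times> B \<subseteq> S"
      unfolding openin_prod_topology_alt by (meson SigmaI subset_trans)
    then have "scott_open X (A \<inter> B) \<and> A \<inter> B \<noteq> {} \<and> (A \<inter> B) \<times> (A \<inter> B) \<subseteq> S"
      unfolding T_def openin_T_open_convergence by (auto intro: scott_open_Int)
    then show "\<exists>C. scott_open X C \<and> C \<noteq> {} \<and> C \<times> C \<subseteq> S"
      by blast
  next
    assume "\<exists>C. scott_open X C \<and> C \<noteq> {} \<and> C \<times> C \<subseteq> S"
    then obtain C where C: "scott_open X C" "C \<noteq> {}" "C \<times> C \<subseteq> S" by blast
    then have "openin ?P (C \<times> C)"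
      by (simp add: openin_prod_Times_iff T_def openin_T_open_convergence)
    with C show "\<exists>U. openin ?P U \<and> ?z \<in> U \<and> U \<subseteq> S"
      using scott_open_nonempty_iff by blast
  qed
  have "nhdsin ?P ?z = nhdsin T2 ?z \<longleftrightarrow> nhdsin ?P ?z \<le> nhdsin T2 ?z"
    using le by (auto intro: antisym)
  then show ?thesis
    by (simp only: nhdsin_le_iff[OF top z] square) (simp add: T2_def openin_T_prod_open_convergence)
qed

theorem theorem13:
  fixes X :: "'a topology"
  shows "infraconsonant X \<longleftrightarrow>
    nhdsin (prod_topology (conv_topology (open_convergence X)) (conv_topology (open_convergence X)))
           (topspace X, topspace X)
  = nhdsin (conv_topology (prod_convergence (open_convergence X) (open_convergence X)))
           (topspace X, topspace X)"
  unfolding nhdsin_prod_eq_iff_squares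
proof (intro iffI allI impI; (elim conjE)?)
  fix S
  assume inf: "infraconsonant X" and S: "scott_open_prod X S" "(topspace X, topspace X) \<in> S"
  define A where "A = {U. openin X U \<and> (U, U) \<in> S}"
  have "scott_open X A" "A \<noteq> {}"
    using scott_open_diagonal[OF S(1)] S(2) by (auto simp: A_def)
  with inf obtain C where C: "scott_open X C" "C \<noteq> {}" "{U \<inter> V |U V. U \<in> C \<and> V \<in> C} \<subseteq> A"
    unfolding infraconsonant_def by meson
  have "(U, V) \<in> S" if "U \<in> C" "V \<in> C" for U V
  proof (rule scott_open_prod_mono[OF S(1)])
    show "(U \<inter> V, U \<inter> V) \<in> S"
      using C(3) that by (auto simp: A_def)
    show "openin X U" "openin X V"
      using C(1) that unfolding scott_open_def by blast+
  qed auto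
  with C show "\<exists>C. scott_open X C \<and> C \<noteq> {} \<and> C \<times> C \<subseteq> S"
    by blast
next
  assume squares: "\<forall>S. scott_open_prod X S \<and> (topspace X, topspace X) \<in> S
    \<longrightarrow> (\<exists>C. scott_open X C \<and> C \<noteq> {} \<and> C \<times> C \<subseteq> S)"
  show "infraconsonant X"
    unfolding infraconsonant_def
  proof (intro allI impI; elim conjE)
    fix A assume A: "scott_open X A" "A \<noteq> {}"
    let ?S = "{(U, V). openin X U \<and> openin X V \<and> U \<inter> V \<in> A}"
    have "(topspace X, topspace X) \<in> ?S"
      using A scott_open_nonempty_iff by auto
    with squares scott_open_prod_Int[OF A(1)]
    obtain C where "scott_open X C" "C \<noteq> {}" "C \<times> C \<subseteq> ?S"
      by meson
    then show "\<exists>C. scott_open X C \<and> C \<noteq> {} \<and> {U \<inter> V |U V. U \<in> C \<and> V \<in> C} \<subseteq> A"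
      by (intro exI[of _ C]) blast
  qed
qed

end
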